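(* The Cantor set $\mathcal{C}=\{0,1\}^{\mathbb{N}}$ (with the product topology) admits a compensation function.
   Context: For a compact Hausdorff space $K$, $\mathcal{M}(K)=C(K)^*$ denotes the space of regular Borel signed (real) measures on $K$, $\omega^*$ its weak$^*$ topology, and $\mu^+$ the positive part of $\mu\in\mathcal{M}(K)$. $\nu\in\mathcal{M}(K)$ is a compensation of $\mu\in\mathcal{M}(K)$ if: $0\le\nu\le\mu^+$ and $\nu(K)=\mu(K)$ in case $\mu(K)>0$; and $\nu=0$ in case $\mu(K)\le 0$. A compensation function for $K$ is an $\omega^*$-$\omega^*$-continuous map $\xi\colon\mathcal{M}(K)\to\mathcal{M}(K)$ such that $\xi(\mu)$ is a compensation of $\mu$ for every $\mu\in\mathcal{M}(K)$; $K$ admits a compensation function if such a map exists. *)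

theory Defs
  imports "HOL-Analysis.Analysis"
begin

text \<open>
  Throughout, \<open>K\<close> stands for a compact Hausdorff space, given as an abstract topology; the
  definitions below are only meant for such \<open>K\<close>.
\<close>

definition borel_algebra :: "'a topology \<Rightarrow> 'a measure" where
  "borel_algebra K = sigma (topspace K) {U. openin K U}"

text \<open>
  A signed measure is a real-valued, countably additive function on the Borel sets (so it is
  finite). It is normalised to be \<open>0\<close> on non-Borel sets, so that equality of signed measures is
  equality of functions.
\<close>

definition signed_borel_measure :: "'a topology \<Rightarrow> ('a set \<Rightarrow> real) \<Rightarrow> bool" where
  "signed_borel_measure K \<mu> \<longleftrightarrow>
     (\<forall>A. range A \<subseteq> sets (borel_algebra K) \<longrightarrow> disjoint_family A \<longrightarrow>
        (\<lambda>i::nat. \<mu> (A i)) sums \<mu> (\<Union>i. A i)) \<and>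
     (\<forall>A. A \<notin> sets (borel_algebra K) \<longrightarrow> \<mu> A = 0)"

text \<open>
  If \<open>P\<close> is the positive set of a Hahn decomposition of \<open>\<mu>\<close>, then
  \<open>\<mu>\<^sup>+ A = \<mu> (A \<inter> P)\<close> is the largest value of \<open>\<mu>\<close> on a Borel subset of \<open>A\<close>. A countably additive
  real-valued \<open>\<mu>\<close> is bounded, so the supremum is over a bounded set.
\<close>

definition pos_part :: "'a topology \<Rightarrow> ('a set \<Rightarrow> real) \<Rightarrow> 'a set \<Rightarrow> real" where
  "pos_part K \<mu> A =
     (if A \<in> sets (borel_algebra K)
      then (SUP B\<in>{B \<in> sets (borel_algebra K). B \<subseteq> A}. \<mu> B) else 0)"

definition neg_part :: "'a topology \<Rightarrow> ('a set \<Rightarrow> real) \<Rightarrow> 'a set \<Rightarrow> real" where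
  "neg_part K \<mu> = pos_part K (\<lambda>A. - \<mu> A)"

definition total_variation :: "'a topology \<Rightarrow> ('a set \<Rightarrow> real) \<Rightarrow> 'a set \<Rightarrow> real" where
  "total_variation K \<mu> A = pos_part K \<mu> A + neg_part K \<mu> A"

definition regular_signed_measure :: "'a topology \<Rightarrow> ('a set \<Rightarrow> real) \<Rightarrow> bool" where
  "regular_signed_measure K \<mu> \<longleftrightarrow>
     (\<forall>A \<in> sets (borel_algebra K).
        total_variation K \<mu> A = (INF U\<in>{U. openin K U \<and> A \<subseteq> U}. total_variation K \<mu> U) \<and>
        total_variation K \<mu> A = (SUP F\<in>{F. compactin K F \<and> F \<subseteq> A}. total_variation K \<mu> F))"

definition signed_measures :: "'a topology \<Rightarrow> ('a set \<Rightarrow> real) set" where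
  "signed_measures K = {\<mu>. signed_borel_measure K \<mu> \<and> regular_signed_measure K \<mu>}"

definition to_measure :: "'a topology \<Rightarrow> ('a set \<Rightarrow> real) \<Rightarrow> 'a measure" where
  "to_measure K \<mu> = measure_of (topspace K) (sets (borel_algebra K)) (\<lambda>A. ennreal (\<mu> A))"

definition signed_integral :: "'a topology \<Rightarrow> ('a set \<Rightarrow> real) \<Rightarrow> ('a \<Rightarrow> real) \<Rightarrow> real" where
  "signed_integral K \<mu> f =
     (\<integral>x. f x \<partial>to_measure K (pos_part K \<mu>)) - (\<integral>x. f x \<partial>to_measure K (neg_part K \<mu>))"

text \<open>
  The weak-star topology is the coarsest topology on \<open>signed_measures K\<close> that makes integration
  of every continuous function on \<open>K\<close> continuous.
\<close>

definition weak_star :: "'a topology \<Rightarrow> ('a set \<Rightarrow> real) topology" where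
  "weak_star K = topology_generated_by
     {{\<mu> \<in> signed_measures K. signed_integral K \<mu> f \<in> V} | f V.
        continuous_map K euclideanreal f \<and> open V}"

lemma topspace_weak_star: "topspace (weak_star K) = signed_measures K"
proof -
  have "signed_measures K \<in> {{\<mu> \<in> signed_measures K. signed_integral K \<mu> f \<in> V} | f V.
        continuous_map K euclideanreal f \<and> open V}"
    by (auto intro!: exI[of _ "\<lambda>_. 0"] exI[of _ UNIV])
  then show ?thesis
    unfolding weak_star_def topology_generated_by_topspace by blast
qed

definition is_compensation ::
    "'a topology \<Rightarrow> ('a set \<Rightarrow> real) \<Rightarrow> ('a set \<Rightarrow> real) \<Rightarrow> bool" where
  "is_compensation K \<mu> \<nu> \<longleftrightarrow>
     \<nu> \<in> signed_measures K \<and>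
     (if \<mu> (topspace K) > 0
      then (\<forall>A \<in> sets (borel_algebra K). 0 \<le> \<nu> A \<and> \<nu> A \<le> pos_part K \<mu> A) \<and>
           \<nu> (topspace K) = \<mu> (topspace K)
      else \<nu> = (\<lambda>_. 0))"

definition compensation_function ::
    "'a topology \<Rightarrow> (('a set \<Rightarrow> real) \<Rightarrow> ('a set \<Rightarrow> real)) \<Rightarrow> bool" where
  "compensation_function K \<xi> \<longleftrightarrow>
     continuous_map (weak_star K) (weak_star K) \<xi> \<and>
     (\<forall>\<mu> \<in> signed_measures K. is_compensation K \<mu> (\<xi> \<mu>))"

definition admits_compensation_function :: "'a topology \<Rightarrow> bool" where
  "admits_compensation_function K \<longleftrightarrow> (\<exists>\<xi>. compensation_function K \<xi>)"

definition cantor_space :: "(nat \<Rightarrow> nat) topology" where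
  "cantor_space = product_topology (\<lambda>_. discrete_topology {0, 1}) UNIV"

lemma compact_space_cantor_space: "compact_space cantor_space"
  unfolding cantor_space_def compact_space_product_topology
  by (simp add: compact_space_discrete_topology)

lemma Hausdorff_space_cantor_space: "Hausdorff_space cantor_space"
  unfolding cantor_space_def Hausdorff_space_product_topology
  by (simp add: Hausdorff_space_discrete_topology)

end

theory Submission
  imports Defs
begin

text \<open>
  Distribute the mass \<open>max 0 (\<mu> \<C>)\<close> over the binary tree of cylinders: the mass \<open>w\<close> of a cylinder
  \<open>C\<close> with halves \<open>C\<^sub>0\<close> and \<open>C\<^sub>1\<close> is split into \<open>min w (max 0 (\<mu> C\<^sub>0))\<close> and the remainder. Since
  \<open>max 0 (\<mu> C) \<le> max 0 (\<mu> C\<^sub>0) + max 0 (\<mu> C\<^sub>1)\<close>, every cylinder \<open>C\<close> receives at most \<open>max 0 (\<mu> C)\<close>,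
  hence at most \<open>\<mu>\<^sup>+ C\<close>. Being dominated by \<open>\<mu>\<^sup>+\<close>, this premeasure extends to a measure
  \<open>\<xi> \<mu> \<le> \<mu>\<^sup>+\<close>. The mass of each cylinder is a weak-star continuous function of \<open>\<mu>\<close>, as it arises from
  finitely many values of \<open>\<mu>\<close> on clopen sets by \<open>min\<close>, \<open>max\<close> and subtraction; and a continuous \<open>f\<close>
  is uniformly approximated by combinations of cylinder indicators, so \<open>\<mu> \<mapsto> \<integral> f d(\<xi> \<mu>)\<close> is locally a
  uniform limit of continuous functions.
\<close>

subsection \<open>Signed Borel measures\<close>

lemma space_borel_algebra [simp]: "space (borel_algebra K) = topspace K"
  by (simp add: borel_algebra_def space_measure_of_conv)

lemma sets_borel_algebra:
  "sets (borel_algebra K) = sigma_sets (topspace K) {U. openin K U}"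
  unfolding borel_algebra_def
  by (rule sets_measure_of) (auto dest: openin_subset)

lemma openin_in_borel_algebra: "openin K U \<Longrightarrow> U \<in> sets (borel_algebra K)"
  by (auto simp: sets_borel_algebra)

lemma closedin_in_borel_algebra:
  assumes "closedin K F"
  shows "F \<in> sets (borel_algebra K)"
proof -
  have "topspace K - (topspace K - F) = F"
    using closedin_subset[OF assms] by blast
  moreover have "topspace K - (topspace K - F) \<in> sets (borel_algebra K)"
    using assms by (metis closedin_def openin_in_borel_algebra sets.compl_sets space_borel_algebra)
  ultimately show ?thesis by simp
qed

lemma borel_subset_topspace: "A \<in> sets (borel_algebra K) \<Longrightarrow> A \<subseteq> topspace K"
  using sets.sets_into_space[of A "borel_algebra K"] by simp

lemma topspace_in_borel_algebra [simp]: "topspace K \<in> sets (borel_algebra K)"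
  by (simp add: openin_in_borel_algebra)

lemma borel_measurable_continuous_map:
  assumes "continuous_map K euclideanreal f" "sets M = sets (borel_algebra K)"
  shows "f \<in> borel_measurable M"
proof (rule borel_measurableI)
  fix S :: "real set" assume "open S"
  then have "openin K {x \<in> topspace K. f x \<in> S}"
    using assms(1) by (auto simp: continuous_map_def)
  moreover have "space M = topspace K"
    using sets_eq_imp_space_eq[OF assms(2)] by simp
  then have "f -` S \<inter> space M = {x \<in> topspace K. f x \<in> S}"
    by auto
  ultimately show "f -` S \<inter> space M \<in> sets M"
    using assms(2) by (simp add: openin_in_borel_algebra)
qed

context
  fixes K :: "'a topology" and \<mu> :: "'a set \<Rightarrow> real"
  assumes \<mu>: "signed_borel_measure K \<mu>"
begin

lemma signed_borel_measure_sums: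
  assumes "range A \<subseteq> sets (borel_algebra K)" "disjoint_family A"
  shows "(\<lambda>i::nat. \<mu> (A i)) sums \<mu> (\<Union>i. A i)"
  using \<mu> assms unfolding signed_borel_measure_def by blast

text \<open>Countable additivity is the only axiom available: applied to the constant sequence of
  empty sets it gives a convergent constant series, whose terms must vanish.\<close>

lemma signed_borel_measure_empty: "\<mu> {} = 0"
proof -
  have "(\<lambda>i::nat. \<mu> {}) sums \<mu> (\<Union>i::nat. {})"
    by (rule signed_borel_measure_sums) (auto simp: disjoint_family_on_def)
  then have "(\<lambda>i::nat. \<mu> {}) \<longlonglongrightarrow> 0"
    using summable_LIMSEQ_zero sums_summable by blast
  then show ?thesis by (simp add: LIMSEQ_const_iff)
qed

lemma signed_borel_measure_Un:
  assumes "A \<in> sets (borel_algebra K)" "B \<in> sets (borel_algebra K)" "A \<inter> B = {}"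
  shows "\<mu> (A \<union> B) = \<mu> A + \<mu> B"
proof -
  have "(\<lambda>n. \<mu> (binaryset A B n)) sums \<mu> (\<Union>i. binaryset A B i)"
    using assms
    by (intro signed_borel_measure_sums)
      (auto simp: range_binaryset_eq disjoint_family_on_def binaryset_def)
  moreover have "(\<lambda>n. \<mu> (binaryset A B n)) sums (\<mu> A + \<mu> B)"
    by (rule binaryset_sums) (rule signed_borel_measure_empty)
  ultimately show ?thesis
    by (metis UN_binaryset_eq sums_unique2)
qed

lemma signed_borel_measure_Diff:
  assumes "A \<in> sets (borel_algebra K)" "B \<in> sets (borel_algebra K)" "B \<subseteq> A"
  shows "\<mu> (A - B) = \<mu> A - \<mu> B"
proof -
  have "\<mu> (A - B \<union> B) = \<mu> (A - B) + \<mu> B"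
    using assms by (intro signed_borel_measure_Un) auto
  moreover have "A - B \<union> B = A" using assms(3) by blast
  ultimately show ?thesis by simp
qed

lemma signed_borel_measure_uminus: "signed_borel_measure K (\<lambda>A. - \<mu> A)"
  using \<mu> unfolding signed_borel_measure_def by (auto intro: sums_minus)

text \<open>
  If \<open>\<mu>\<close> is unbounded on the subsets of \<open>A\<close>, then \<open>A\<close> splits into two parts of measure at least
  \<open>1\<close> in absolute value, and \<open>\<mu>\<close> is unbounded on one of them; splitting repeatedly contradicts
  countable additivity.
\<close>
lemma signed_borel_measure_bounded: "\<exists>b. \<forall>A\<in>sets (borel_algebra K). \<bar>\<mu> A\<bar> \<le> b"
proof (rule ccontr)
  let ?M = "sets (borel_algebra K)"
  define unb where "unb A \<longleftrightarrow> (\<forall>b. \<exists>B\<in>?M. B \<subseteq> A \<and> \<bar>\<mu> B\<bar> > b)" for A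
  assume contra: "\<nexists>b. \<forall>A\<in>?M. \<bar>\<mu> A\<bar> \<le> b"
  have "unb (topspace K)"
    unfolding unb_def
  proof
    fix b
    obtain A where "A \<in> ?M" "\<not> \<bar>\<mu> A\<bar> \<le> b" using contra by blast
    then show "\<exists>B\<in>?M. B \<subseteq> topspace K \<and> \<bar>\<mu> B\<bar> > b"
      by (auto intro!: bexI[of _ A] dest: borel_subset_topspace)
  qed
  have step: "\<exists>A'. (A' \<in> ?M \<and> unb A') \<and> A' \<subseteq> A \<and> \<bar>\<mu> (A - A')\<bar> > 1"
    if A: "A \<in> ?M" "unb A" for A
  proof -
    \<comment> \<open>The margin \<open>\<bar>\<mu> A\<bar> + 1\<close> puts both
      \<open>\<bar>\<mu> B\<bar>\<close> and \<open>\<bar>\<mu> (A - B)\<bar>\<close> above 1, so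
      whichever half stays unbounded can be kept and the other split off.\<close>
    obtain B where B: "B \<in> ?M" "B \<subseteq> A" "\<bar>\<mu> B\<bar> > \<bar>\<mu> A\<bar> + 1"
      using A unfolding unb_def by blast
    have diff: "\<mu> (A - B) = \<mu> A - \<mu> B" "A - B \<in> ?M"
      using signed_borel_measure_Diff A B by auto
    have "unb B \<or> unb (A - B)"
    proof (rule ccontr)
      assume "\<not> (unb B \<or> unb (A - B))"
      then obtain b1 b2 where b1: "\<And>C. C \<in> ?M \<Longrightarrow> C \<subseteq> B \<Longrightarrow> \<bar>\<mu> C\<bar> \<le> b1"
        and b2: "\<And>C. C \<in> ?M \<Longrightarrow> C \<subseteq> A - B \<Longrightarrow> \<bar>\<mu> C\<bar> \<le> b2"
        unfolding unb_def by (meson not_less)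
      obtain C where C: "C \<in> ?M" "C \<subseteq> A" "\<bar>\<mu> C\<bar> > b1 + b2"
        using A unfolding unb_def by blast
      have "\<mu> (C \<inter> B \<union> (C - B)) = \<mu> (C \<inter> B) + \<mu> (C - B)"
        using C B by (intro signed_borel_measure_Un) auto
      moreover have "C \<inter> B \<union> (C - B) = C" by blast
      moreover have "\<bar>\<mu> (C \<inter> B)\<bar> \<le> b1" using B C by (intro b1) auto
      moreover have "\<bar>\<mu> (C - B)\<bar> \<le> b2" using B C by (intro b2) auto
      ultimately show False using C(3) by simp
    qed
    then show ?thesis
    proof
      assume "unb B"
      moreover have "\<bar>\<mu> (A - B)\<bar> > 1" using B(3) diff by linarith
      ultimately show ?thesis using B by blast
    next
      assume "unb (A - B)"
      moreover have "\<bar>\<mu> (A - (A - B))\<bar> > 1"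
        using B by (simp add: double_diff)
      ultimately show ?thesis using diff by blast
    qed
  qed
  have "\<exists>A. \<forall>n::nat. (A n \<in> ?M \<and> unb (A n)) \<and> A (Suc n) \<subseteq> A n \<and> \<bar>\<mu> (A n - A (Suc n))\<bar> > 1"
  proof (rule dependent_nat_choice)
    show "\<exists>A. A \<in> ?M \<and> unb A"
      using \<open>unb (topspace K)\<close> topspace_in_borel_algebra by blast
  qed (rule step, simp_all)
  then obtain A where A: "\<And>n::nat. A n \<in> ?M" "\<And>n. A (Suc n) \<subseteq> A n"
    "\<And>n. \<bar>\<mu> (A n - A (Suc n))\<bar> > 1"
    by blast
  have "decseq A" using A(2) by (rule decseq_SucI)
  \<comment> \<open>The pieces split off are disjoint, so their measures form a convergent series;
    its terms tend to 0, although each exceeds 1 in absolute value.\<close>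
  have "disjoint_family (\<lambda>n. A n - A (Suc n))"
    unfolding disjoint_family_on_def
  proof (intro ballI impI)
    fix m n :: nat assume "m \<noteq> n"
    moreover have "(A i - A (Suc i)) \<inter> (A j - A (Suc j)) = {}" if "i < j" for i j
      using decseqD[OF \<open>decseq A\<close>, of "Suc i" j] that by auto
    ultimately show "(A m - A (Suc m)) \<inter> (A n - A (Suc n)) = {}"
      by (metis Int_commute nat_neq_iff)
  qed
  then have "(\<lambda>n. \<mu> (A n - A (Suc n))) sums \<mu> (\<Union>n. A n - A (Suc n))"
    using A(1) by (intro signed_borel_measure_sums) auto
  then have "(\<lambda>n. \<mu> (A n - A (Suc n))) \<longlonglongrightarrow> 0"
    using summable_LIMSEQ_zero sums_summable by blast
  then obtain n where "\<bar>\<mu> (A n - A (Suc n))\<bar> < 1"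
    by (auto dest!: LIMSEQ_D[of _ _ 1])
  then show False using A(3)[of n] by simp
qed

section \<open>Positive and negative parts of a signed measure\<close>

lemma bdd_above_signed_borel_measure:
  "bdd_above (\<mu> ` {B \<in> sets (borel_algebra K). B \<subseteq> A})"
  using signed_borel_measure_bounded by (fastforce simp: bdd_above_def abs_le_iff)

lemma pos_part_ge:
  assumes "A \<in> sets (borel_algebra K)" "B \<in> sets (borel_algebra K)" "B \<subseteq> A"
  shows "\<mu> B \<le> pos_part K \<mu> A"
  using assms by (auto simp: pos_part_def intro!: cSUP_upper bdd_above_signed_borel_measure)

lemma pos_part_le:
  assumes "A \<in> sets (borel_algebra K)"
    and "\<And>B. B \<in> sets (borel_algebra K) \<Longrightarrow> B \<subseteq> A \<Longrightarrow> \<mu> B \<le> c"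
  shows "pos_part K \<mu> A \<le> c"
  using assms by (auto simp: pos_part_def intro!: cSUP_least)

lemma pos_part_nonneg: "0 \<le> pos_part K \<mu> A"
  using pos_part_ge[of A "{}"] signed_borel_measure_empty
  by (cases "A \<in> sets (borel_algebra K)") (auto simp: pos_part_def)

lemma pos_part_mono:
  assumes "A \<in> sets (borel_algebra K)" "B \<in> sets (borel_algebra K)" "A \<subseteq> B"
  shows "pos_part K \<mu> A \<le> pos_part K \<mu> B"
  using assms by (intro pos_part_le pos_part_ge) auto

text \<open>A Borel subset of \<open>A \<union> B\<close> splits into its traces on \<open>A\<close>
  and \<open>B\<close>, which gives one inequality. For the other, subsets \<open>C\<close> of
  \<open>A\<close> and \<open>D\<close> of \<open>B\<close> are joined to a subset of
  \<open>A \<union> B\<close>, and the supremum is taken first over \<open>C\<close>, then over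
  \<open>D\<close>.\<close>

lemma pos_part_Un:
  assumes "A \<in> sets (borel_algebra K)" "B \<in> sets (borel_algebra K)" "A \<inter> B = {}"
  shows "pos_part K \<mu> (A \<union> B) = pos_part K \<mu> A + pos_part K \<mu> B"
proof (rule antisym)
  show "pos_part K \<mu> (A \<union> B) \<le> pos_part K \<mu> A + pos_part K \<mu> B"
  proof (rule pos_part_le)
    fix C assume C: "C \<in> sets (borel_algebra K)" "C \<subseteq> A \<union> B"
    have "\<mu> ((C \<inter> A) \<union> (C \<inter> B)) = \<mu> (C \<inter> A) + \<mu> (C \<inter> B)"
      using assms C by (intro signed_borel_measure_Un) auto
    moreover have "(C \<inter> A) \<union> (C \<inter> B) = C" using C by blast
    moreover have "\<mu> (C \<inter> A) \<le> pos_part K \<mu> A" "\<mu> (C \<inter> B) \<le> pos_part K \<mu> B"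
      using assms C by (auto intro!: pos_part_ge)
    ultimately show "\<mu> C \<le> pos_part K \<mu> A + pos_part K \<mu> B" by simp
  qed (use assms in auto)
  have "\<mu> C \<le> pos_part K \<mu> (A \<union> B) - \<mu> D"
    if "C \<in> sets (borel_algebra K)" "C \<subseteq> A" "D \<in> sets (borel_algebra K)" "D \<subseteq> B" for C D
  proof -
    have "\<mu> (C \<union> D) = \<mu> C + \<mu> D"
      using that assms by (intro signed_borel_measure_Un) auto
    moreover have "\<mu> (C \<union> D) \<le> pos_part K \<mu> (A \<union> B)"
      using that assms by (intro pos_part_ge) auto
    ultimately show ?thesis by simp
  qed
  then have "pos_part K \<mu> A \<le> pos_part K \<mu> (A \<union> B) - \<mu> D"
    if "D \<in> sets (borel_algebra K)" "D \<subseteq> B" for D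
    using that assms by (intro pos_part_le) auto
  then have "pos_part K \<mu> B \<le> pos_part K \<mu> (A \<union> B) - pos_part K \<mu> A"
    using assms by (intro pos_part_le) (auto simp: algebra_simps)
  then show "pos_part K \<mu> A + pos_part K \<mu> B \<le> pos_part K \<mu> (A \<union> B)" by simp
qed

lemma pos_part_empty: "pos_part K \<mu> {} = 0"
  using pos_part_Un[of "{}" "{}"] by simp

text \<open>Finite additivity and monotonicity bound the partial sums by the value on the union.
  Conversely, a Borel subset \<open>B\<close> of the union has \<open>\<mu> B\<close> equal to the
  series of its traces \<open>B \<inter> A i\<close>, which is dominated termwise.\<close>

lemma pos_part_sums:
  assumes A: "range A \<subseteq> sets (borel_algebra K)" "disjoint_family A"
  shows "(\<lambda>i::nat. pos_part K \<mu> (A i)) sums pos_part K \<mu> (\<Union>i. A i)"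
proof -
  let ?p = "pos_part K \<mu>"
  have U: "(\<Union>i. A i) \<in> sets (borel_algebra K)" using A by auto
  have "(\<Sum>i<n. ?p (A i)) = ?p (\<Union>i<n. A i)" for n
  proof (induction n)
    case (Suc n)
    have "?p (\<Union>i<Suc n. A i) = ?p ((\<Union>i<n. A i) \<union> A n)"
      by (simp only: lessThan_Suc UN_insert Un_commute)
    also have "\<dots> = ?p (\<Union>i<n. A i) + ?p (A n)"
    proof (rule pos_part_Un)
      have "A i \<inter> A n = {}" if "i < n" for i
        using disjoint_family_onD[OF A(2), of i n] that by simp
      then show "(\<Union>i<n. A i) \<inter> A n = {}" by blast
    qed (use A in auto)
    finally show ?case using Suc by simp
  qed (simp add: pos_part_empty)
  then have le: "(\<Sum>i<n. ?p (A i)) \<le> ?p (\<Union>i. A i)" for n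
    using A U by (auto intro!: pos_part_mono)
  then have summ: "summable (\<lambda>i. ?p (A i))"
    using pos_part_nonneg by (intro summableI_nonneg_bounded) auto
  have "?p (\<Union>i. A i) \<le> (\<Sum>i. ?p (A i))"
  proof (rule pos_part_le[OF U])
    fix B assume B: "B \<in> sets (borel_algebra K)" "B \<subseteq> (\<Union>i. A i)"
    have "(\<lambda>i. \<mu> (B \<inter> A i)) sums \<mu> (\<Union>i. B \<inter> A i)"
      using A B by (intro signed_borel_measure_sums) (auto simp: disjoint_family_on_def)
    moreover have "(\<Union>i. B \<inter> A i) = B" using B by blast
    ultimately have "(\<lambda>i. \<mu> (B \<inter> A i)) sums \<mu> B" by simp
    moreover have "\<mu> (B \<inter> A i) \<le> ?p (A i)" for i
      using A B by (intro pos_part_ge) auto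
    ultimately show "\<mu> B \<le> (\<Sum>i. ?p (A i))"
      by (rule sums_le[OF _ _ summable_sums[OF summ], rotated])
  qed
  moreover have "(\<Sum>i. ?p (A i)) \<le> ?p (\<Union>i. A i)"
    using le summ by (intro suminf_le_const) auto
  ultimately show ?thesis
    using summ by (metis antisym summable_sums)
qed

end

text \<open>The Jordan decomposition without a Hahn set: replacing \<open>B\<close> by
  \<open>A - B\<close> turns a competitor for one supremum into a competitor for the other, shifted
  by \<open>\<mu> A\<close>.\<close>

lemma neg_part_eq:
  assumes \<mu>: "signed_borel_measure K \<mu>" and A: "A \<in> sets (borel_algebra K)"
  shows "neg_part K \<mu> A = pos_part K \<mu> A - \<mu> A"
proof (rule antisym)
  note neg = signed_borel_measure_uminus[OF \<mu>]
  show "neg_part K \<mu> A \<le> pos_part K \<mu> A - \<mu> A"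
    unfolding neg_part_def
  proof (rule pos_part_le[OF neg A])
    fix B assume B: "B \<in> sets (borel_algebra K)" "B \<subseteq> A"
    have "\<mu> (A - B) \<le> pos_part K \<mu> A"
      using A B by (intro pos_part_ge[OF \<mu>]) auto
    then show "- \<mu> B \<le> pos_part K \<mu> A - \<mu> A"
      using signed_borel_measure_Diff[OF \<mu> A B] by simp
  qed
  have "pos_part K \<mu> A \<le> neg_part K \<mu> A + \<mu> A"
  proof (rule pos_part_le[OF \<mu> A])
    fix B assume B: "B \<in> sets (borel_algebra K)" "B \<subseteq> A"
    have "- \<mu> (A - B) \<le> neg_part K \<mu> A"
      unfolding neg_part_def using A B by (intro pos_part_ge[OF neg]) auto
    then show "\<mu> B \<le> neg_part K \<mu> A + \<mu> A"
      using signed_borel_measure_Diff[OF \<mu> A B] by simp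
  qed
  then show "pos_part K \<mu> A - \<mu> A \<le> neg_part K \<mu> A" by simp
qed

text \<open>Real-valued convergence of nonnegative terms carries over to \<open>ennreal\<close>, so
  \<open>p\<close> is a genuine measure. The set function is kept general to cover
  \<open>pos_part\<close>, \<open>measure N\<close> and the zero function alike.\<close>

lemma
  assumes sums: "\<And>A. range A \<subseteq> sets (borel_algebra K) \<Longrightarrow> disjoint_family A \<Longrightarrow>
      (\<lambda>i::nat. p (A i)) sums p (\<Union>i. A i)"
    and nonneg: "\<And>A. 0 \<le> p A" and empty: "p {} = 0"
  shows sets_to_measure: "sets (to_measure K p) = sets (borel_algebra K)"
    and emeasure_to_measure:
      "A \<in> sets (borel_algebra K) \<Longrightarrow> emeasure (to_measure K p) A = ennreal (p A)"
    and finite_measure_to_measure: "finite_measure (to_measure K p)"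
proof -
  have sub: "sets (borel_algebra K) \<subseteq> Pow (topspace K)"
    by (auto dest: borel_subset_topspace)
  have alg: "sigma_algebra (topspace K) (sets (borel_algebra K))"
    using sets.sigma_algebra_axioms[of "borel_algebra K"] by simp
  show s: "sets (to_measure K p) = sets (borel_algebra K)"
    unfolding to_measure_def
    using sub alg by (simp add: sets_measure_of sigma_algebra.sigma_sets_eq)
  show e: "emeasure (to_measure K p) A = ennreal (p A)" if "A \<in> sets (borel_algebra K)" for A
    unfolding to_measure_def
  proof (rule emeasure_measure_of_sigma[OF alg])
    show "countably_additive (sets (borel_algebra K)) (\<lambda>A. ennreal (p A))"
      unfolding countably_additive_def
      by (intro allI impI suminf_ennreal_eq nonneg sums)
  qed (use that empty in \<open>auto simp: positive_def\<close>)
  have "space (to_measure K p) = topspace K"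
    using sets_eq_imp_space_eq[OF s] by simp
  then show "finite_measure (to_measure K p)"
    using e by (intro finite_measureI) simp
qed

text \<open>Recovers values of \<open>\<mu>\<close> from integrals: when \<open>A\<close> is clopen
  its indicator is continuous, so evaluation at \<open>A\<close> becomes weak-star continuous. The
  identity itself is the Jordan decomposition.\<close>

lemma signed_integral_indicator:
  assumes \<mu>: "signed_borel_measure K \<mu>" and A: "A \<in> sets (borel_algebra K)"
  shows "signed_integral K \<mu> (indicator A) = \<mu> A"
proof -
  have int: "(\<integral>x. indicator A x \<partial>to_measure K (pos_part K \<rho>)) = pos_part K \<rho> A"
    if "signed_borel_measure K \<rho>" for \<rho>
  proof -
    note * = pos_part_sums[OF that] pos_part_nonneg[OF that] pos_part_empty[OF that]
    have "space (to_measure K (pos_part K \<rho>)) = topspace K"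
      using sets_eq_imp_space_eq[OF sets_to_measure[of K "pos_part K \<rho>", OF *]] by simp
    then have "A \<inter> space (to_measure K (pos_part K \<rho>)) = A"
      using borel_subset_topspace[OF A] by blast
    moreover have "measure (to_measure K (pos_part K \<rho>)) A = pos_part K \<rho> A"
      using emeasure_to_measure[of K "pos_part K \<rho>", OF * A] *(2)
      by (simp add: measure_def)
    ultimately show ?thesis by (simp add: integral_indicator)
  qed
  show ?thesis
    using int[OF \<mu>] int[OF signed_borel_measure_uminus[OF \<mu>]] neg_part_eq[OF \<mu> A]
    by (simp add: signed_integral_def neg_part_def)
qed

subsection \<open>Dominated measures\<close>

context
  fixes K :: "'a topology" and N :: "'a measure"
  assumes sets_N: "sets N = sets (borel_algebra K)" and fin_N: "finite_measure N"
begin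

interpretation finite_measure N by (rule fin_N)

text \<open>\<open>measure\<close> is 0 outside the \<sigma>-algebra, which matches the
  normalisation built into signed measures.\<close>

lemma signed_borel_measure_measure: "signed_borel_measure K (measure N)"
  unfolding signed_borel_measure_def
  using finite_measure_UNION sets_N by (auto simp: measure_notin_sets)

lemma pos_part_measure: "pos_part K (measure N) = measure N"
proof
  fix A
  show "pos_part K (measure N) A = measure N A"
  proof (cases "A \<in> sets (borel_algebra K)")
    case True
    show ?thesis
    proof (rule antisym)
      show "pos_part K (measure N) A \<le> measure N A"
        using True sets_N
        by (intro pos_part_le[OF signed_borel_measure_measure]) (auto intro: finite_measure_mono)
      show "measure N A \<le> pos_part K (measure N) A"
        using True by (intro pos_part_ge[OF signed_borel_measure_measure]) auto
    qed
  next
    case False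
    then show ?thesis using sets_N by (simp add: pos_part_def measure_notin_sets)
  qed
qed

lemma neg_part_measure: "neg_part K (measure N) = (\<lambda>_. 0)"
proof
  fix A
  show "neg_part K (measure N) A = 0"
  proof (cases "A \<in> sets (borel_algebra K)")
    case True
    then show ?thesis
      using neg_part_eq[OF signed_borel_measure_measure True] by (simp add: pos_part_measure)
  qed (simp add: neg_part_def pos_part_def)
qed

lemma total_variation_measure: "total_variation K (measure N) = measure N"
  by (simp add: total_variation_def fun_eq_iff pos_part_measure neg_part_measure)

text \<open>The negative part vanishes and the positive part gives back \<open>N\<close>, so
  continuity of the compensation can be argued with ordinary integrals.\<close>

lemma signed_integral_measure: "signed_integral K (measure N) f = (\<integral>x. f x \<partial>N)"
proof -
  have "to_measure K (measure N) = N"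
  proof (rule measure_eqI)
    have *: "(\<lambda>i. measure N (A i)) sums measure N (\<Union>i. A i)"
      if "range A \<subseteq> sets (borel_algebra K)" "disjoint_family A" for A :: "nat \<Rightarrow> 'a set"
      using finite_measure_UNION that sets_N by simp
    show sets: "sets (to_measure K (measure N)) = sets N"
      using sets_to_measure[of K "measure N", OF *] sets_N by simp
    fix A assume "A \<in> sets (to_measure K (measure N))"
    then show "emeasure (to_measure K (measure N)) A = emeasure N A"
      using emeasure_to_measure[of K "measure N", OF *] sets sets_N by (simp add: emeasure_eq_measure)
  qed
  moreover have "to_measure K (\<lambda>_. 0) = null_measure N"
  proof (rule measure_eqI)
    show sets: "sets (to_measure K (\<lambda>_. 0)) = sets (null_measure N)"
      using sets_to_measure[of K "\<lambda>_. 0"] sets_N by simp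
    fix A assume "A \<in> sets (to_measure K (\<lambda>_. 0))"
    then show "emeasure (to_measure K (\<lambda>_. 0)) A = emeasure (null_measure N) A"
      using emeasure_to_measure[of K "\<lambda>_. 0"] sets sets_N by simp
  qed
  ultimately show ?thesis
    by (simp add: signed_integral_def pos_part_measure neg_part_measure)
qed

text \<open>Regularity is inherited: by domination on \<open>B - A\<close>, the increment of
  \<open>N\<close> from \<open>A\<close> to \<open>B\<close> is at most that of the total variation
  of \<open>\<mu>\<close>. Open and compact sets approximating \<open>A\<close> for the latter
  therefore do so for \<open>N\<close>.\<close>

lemma signed_measures_dominated:
  assumes haus: "Hausdorff_space K" and \<mu>: "\<mu> \<in> signed_measures K"
    and le: "\<And>A. A \<in> sets (borel_algebra K) \<Longrightarrow> measure N A \<le> pos_part K \<mu> A"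
  shows "measure N \<in> signed_measures K"
proof -
  let ?M = "sets (borel_algebra K)" and ?t = "total_variation K \<mu>"
  have sgn: "signed_borel_measure K \<mu>" and reg: "regular_signed_measure K \<mu>"
    using \<mu> by (auto simp: signed_measures_def)
  note sgn' = signed_borel_measure_uminus[OF sgn]
  have le_t: "measure N A \<le> ?t A" if "A \<in> ?M" for A
    using le[OF that] pos_part_nonneg[OF sgn', of A] by (simp add: total_variation_def neg_part_def)
  have diff: "measure N B - measure N A \<le> ?t B - ?t A"
    if "A \<in> ?M" "B \<in> ?M" "A \<subseteq> B" for A B
  proof -
    have "?t (A \<union> (B - A)) = ?t A + ?t (B - A)"
      using pos_part_Un[OF sgn, of A "B - A"] pos_part_Un[OF sgn', of A "B - A"] that
      by (simp add: total_variation_def neg_part_def)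
    moreover have "A \<union> (B - A) = B" using that by blast
    moreover have "measure N (B - A) = measure N B - measure N A"
      using that sets_N by (intro finite_measure_Diff) auto
    moreover have "measure N (B - A) \<le> ?t (B - A)" using that by (intro le_t) auto
    ultimately show ?thesis by simp
  qed
  have t_nonneg: "0 \<le> ?t A" for A
    using pos_part_nonneg[OF sgn] pos_part_nonneg[OF sgn'] by (simp add: total_variation_def neg_part_def)
  have t_mono: "?t A \<le> ?t B" if "A \<in> ?M" "B \<in> ?M" "A \<subseteq> B" for A B
    using pos_part_mono[OF sgn that] pos_part_mono[OF sgn' that] by (simp add: total_variation_def neg_part_def)
  \<comment> \<open>Hausdorffness makes compact sets closed, hence Borel, so that
    \<open>diff\<close> applies to the inner approximations.\<close>
  have compact_borel: "F \<in> ?M" if "compactin K F" for F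
    using that haus by (intro closedin_in_borel_algebra compactin_imp_closedin)
  have "measure N A = (INF U\<in>{U. openin K U \<and> A \<subseteq> U}. measure N U)"
    "measure N A = (SUP F\<in>{F. compactin K F \<and> F \<subseteq> A}. measure N F)" if A: "A \<in> ?M" for A
  proof -
    have ne: "{U. openin K U \<and> A \<subseteq> U} \<noteq> {}"
      using borel_subset_topspace[OF A] by blast
    have ne': "{F. compactin K F \<and> F \<subseteq> A} \<noteq> {}"
      by (auto intro: exI[of _ "{}"])
    have tI: "?t A = (INF U\<in>{U. openin K U \<and> A \<subseteq> U}. ?t U)"
      and tS: "?t A = (SUP F\<in>{F. compactin K F \<and> F \<subseteq> A}. ?t F)"
      using reg A by (auto simp: regular_signed_measure_def)
    show "measure N A = (INF U\<in>{U. openin K U \<and> A \<subseteq> U}. measure N U)"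
    proof (rule antisym)
      show "measure N A \<le> (INF U\<in>{U. openin K U \<and> A \<subseteq> U}. measure N U)"
        using ne A sets_N
        by (intro cINF_greatest finite_measure_mono) (auto simp: openin_in_borel_algebra)
      show "(INF U\<in>{U. openin K U \<and> A \<subseteq> U}. measure N U) \<le> measure N A"
      proof (rule field_le_epsilon)
        fix e :: real assume "e > 0"
        then have "(INF U\<in>{U. openin K U \<and> A \<subseteq> U}. ?t U) < ?t A + e" using tI by simp
        then obtain U where U: "openin K U" "A \<subseteq> U" "?t U < ?t A + e"
          using ne t_nonneg by (subst (asm) cINF_less_iff) (auto intro!: bdd_belowI2[of _ 0])
        then have "measure N U \<le> measure N A + e"
          using diff[OF A openin_in_borel_algebra, of U] by simp
        moreover have "(INF U\<in>{U. openin K U \<and> A \<subseteq> U}. measure N U) \<le> measure N U"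
          using U by (intro cINF_lower bdd_belowI2[of _ 0]) auto
        ultimately show "(INF U\<in>{U. openin K U \<and> A \<subseteq> U}. measure N U) \<le> measure N A + e"
          by simp
      qed
    qed
    show "measure N A = (SUP F\<in>{F. compactin K F \<and> F \<subseteq> A}. measure N F)"
    proof (rule antisym)
      show "(SUP F\<in>{F. compactin K F \<and> F \<subseteq> A}. measure N F) \<le> measure N A"
        using ne' A sets_N by (intro cSUP_least finite_measure_mono) auto
      show "measure N A \<le> (SUP F\<in>{F. compactin K F \<and> F \<subseteq> A}. measure N F)"
      proof (rule field_le_epsilon)
        fix e :: real assume "e > 0"
        then have "?t A - e < (SUP F\<in>{F. compactin K F \<and> F \<subseteq> A}. ?t F)" using tS by simp
        then obtain F where F: "compactin K F" "F \<subseteq> A" "?t A - e < ?t F"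
          using ne' A t_mono compact_borel
          by (subst (asm) less_cSUP_iff) (auto intro!: bdd_aboveI2[of _ _ "?t A"])
        then have "measure N A \<le> measure N F + e"
          using diff[OF compact_borel A, of F] by simp
        moreover have "measure N F \<le> (SUP F\<in>{F. compactin K F \<and> F \<subseteq> A}. measure N F)"
          using F A sets_N
          by (intro cSUP_upper bdd_aboveI2[of _ _ "measure N A"] finite_measure_mono) auto
        ultimately show "measure N A \<le> (SUP F\<in>{F. compactin K F \<and> F \<subseteq> A}. measure N F) + e"
          by simp
      qed
    qed
  qed
  then show ?thesis
    using signed_borel_measure_measure
    by (simp add: signed_measures_def regular_signed_measure_def total_variation_measure)
qed

end

section \<open>Extension of dominated premeasures from an algebra\<close>

text \<open>The Caratheodory theorem asks for continuity at the empty set. It is inherited from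
  \<open>M\<close>: if \<open>A i\<close> decreases to the empty set, then \<open>f (A i)\<close> is
  squeezed between 0 and \<open>measure M (A i)\<close>, which tends to 0.\<close>

lemma (in finite_measure) dominated_premeasure_extension:
  fixes G :: "'a set set"
  assumes alg: "algebra (space M) G" and sets: "sets M = sigma_sets (space M) G"
    and nonneg: "\<And>A. A \<in> G \<Longrightarrow> 0 \<le> f A"
    and add: "\<And>A B. A \<in> G \<Longrightarrow> B \<in> G \<Longrightarrow> A \<inter> B = {} \<Longrightarrow> f (A \<union> B) = f A + f B"
    and le: "\<And>A. A \<in> G \<Longrightarrow> f A \<le> measure M A"
  obtains N where "finite_measure N" "sets N = sets M" "\<And>A. A \<in> G \<Longrightarrow> measure N A = f A"
proof -
  interpret G: algebra "space M" G by (rule alg)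
  have G: "A \<in> sets M" if "A \<in> G" for A
    using that sets by (simp add: sigma_sets.Basic)
  have "f {} = 0" using add[of "{}" "{}"] by simp
  have "\<exists>m :: 'a set \<Rightarrow> ennreal. (\<forall>A\<in>G. m A = ennreal (f A)) \<and>
      measure_space (space M) (sigma_sets (space M) G) m"
  proof (rule G.caratheodory_empty_continuous)
    show "positive G (\<lambda>A. ennreal (f A))"
      using \<open>f {} = 0\<close> by (simp add: positive_def)
    show "additive G (\<lambda>A. ennreal (f A))"
      using add nonneg by (auto simp: additive_def)
    fix A :: "nat \<Rightarrow> 'a set" assume A: "range A \<subseteq> G" "decseq A" "(\<Inter>i. A i) = {}"
    have "(\<lambda>i. measure M (A i)) \<longlonglongrightarrow> measure M (\<Inter>i. A i)"
      using A G by (intro finite_Lim_measure_decseq) auto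
    then have lim: "(\<lambda>i. measure M (A i)) \<longlonglongrightarrow> 0" using A by simp
    have "(\<lambda>i. f (A i)) \<longlonglongrightarrow> 0"
      by (rule tendsto_sandwich[OF _ _ tendsto_const lim])
        (use A nonneg le in \<open>auto intro!: always_eventually\<close>)
    then show "(\<lambda>i. ennreal (f (A i))) \<longlonglongrightarrow> 0"
      using tendsto_ennrealI by fastforce
  qed simp
  then obtain m :: "'a set \<Rightarrow> ennreal" where m: "\<And>A. A \<in> G \<Longrightarrow> m A = ennreal (f A)"
    and ms: "measure_space (space M) (sets M) m"
    using sets by auto
  define N where "N = measure_of (space M) (sets M) m"
  have sets_N: "sets N = sets M"
    unfolding N_def by simp
  have emeasure_N: "emeasure N A = m A" if "A \<in> sets M" for A
    unfolding N_def using ms that by (intro emeasure_measure_of_sigma) (auto simp: measure_space_def)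
  have N: "emeasure N A = ennreal (f A)" if "A \<in> G" for A
    using emeasure_N[OF G[OF that]] m[OF that] by simp
  show ?thesis
  proof (rule that)
    have "space N = space M" using sets_N by (rule sets_eq_imp_space_eq)
    then show "finite_measure N" using N[OF G.top] by (intro finite_measureI) simp
    show "measure N A = f A" if "A \<in> G" for A
      using N[OF that] nonneg[OF that] by (simp add: measure_def)
  qed (rule sets_N)
qed

text \<open>
  Domination passes from the algebra to the \<open>\<sigma>\<close>-algebra because \<open>measure M - f\<close> extends to a
  measure as well.
\<close>
lemma (in finite_measure) dominated_premeasure_extension_le:
  fixes G :: "'a set set"
  assumes alg: "algebra (space M) G" and sets: "sets M = sigma_sets (space M) G"
    and nonneg: "\<And>A. A \<in> G \<Longrightarrow> 0 \<le> f A"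
    and add: "\<And>A B. A \<in> G \<Longrightarrow> B \<in> G \<Longrightarrow> A \<inter> B = {} \<Longrightarrow> f (A \<union> B) = f A + f B"
    and le: "\<And>A. A \<in> G \<Longrightarrow> f A \<le> measure M A"
  obtains N where "finite_measure N" "sets N = sets M" "\<And>A. A \<in> G \<Longrightarrow> measure N A = f A"
    "\<And>A. A \<in> sets M \<Longrightarrow> measure N A \<le> measure M A"
proof -
  interpret G: algebra "space M" G by (rule alg)
  have G: "A \<in> sets M" if "A \<in> G" for A
    using that sets by (simp add: sigma_sets.Basic)
  obtain N where N: "finite_measure N" "sets N = sets M" "\<And>A. A \<in> G \<Longrightarrow> measure N A = f A"
    using dominated_premeasure_extension[OF assms] by blast
  obtain N' where N': "finite_measure N'" "sets N' = sets M"
    "\<And>A. A \<in> G \<Longrightarrow> measure N' A = measure M A - f A"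
  proof (rule dominated_premeasure_extension[OF alg sets, of "\<lambda>A. measure M A - f A"])
    fix A B assume "A \<in> G" "B \<in> G" "A \<inter> B = {}"
    then show "measure M (A \<union> B) - f (A \<union> B) = measure M A - f A + (measure M B - f B)"
      using add[of A B] finite_measure_Union[of A B] G by simp
  qed (use le nonneg in auto)
  interpret N: finite_measure N by (rule N(1))
  interpret N': finite_measure N' by (rule N'(1))
  have sp: "space N = space M" "space N' = space M"
    using N(2) N'(2) by (auto dest: sets_eq_imp_space_eq)
  have int_stable: "Int_stable G" using G.Int by (auto simp: Int_stable_def)
  \<comment> \<open>Both sides agree on \<open>G\<close>, which is stable under intersection;
    complements and countable disjoint unions preserve the equality, so Dynkin's theorem carries it
    to the generated \<sigma>-algebra.\<close>
  have eq: "measure N A + measure N' A = measure M A" if "A \<in> sigma_sets (space M) G" for A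
    using int_stable G.space_closed that
  proof (induction rule: sigma_sets_induct_disjoint)
    case (compl A)
    then show ?case
      using finite_measure_compl[of A] N.finite_measure_compl[of A] N'.finite_measure_compl[of A]
        N(2,3) N'(2,3) sp sets G.top by simp
  next
    case (union A)
    then have "(\<lambda>i. measure N (A i) + measure N' (A i)) sums
        (measure N (\<Union>i. A i) + measure N' (\<Union>i. A i))"
      using N(2) N'(2) sets
      by (intro sums_add N.finite_measure_UNION N'.finite_measure_UNION) auto
    moreover have "(\<lambda>i. measure M (A i)) sums measure M (\<Union>i. A i)"
      using union sets by (intro finite_measure_UNION) auto
    ultimately show ?case using union.IH sums_unique2 by auto
  qed (use N(3) N'(3) in auto)
  then have "measure N A \<le> measure M A" if "A \<in> sets M" for A
    using eq[OF that[unfolded sets]] measure_nonneg[of N' A] by linarith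
  then show ?thesis using that N by blast
qed

subsection \<open>Cylinders of the Cantor space\<close>

abbreviation cantor :: "(nat \<Rightarrow> nat) set" where
  "cantor \<equiv> topspace cantor_space"

lemma mem_cantor_iff: "x \<in> cantor \<longleftrightarrow> (\<forall>i. x i = 0 \<or> x i = 1)"
  by (auto simp: cantor_space_def topspace_product_topology PiE_iff)

lemma fun_upd_in_cantor: "x \<in> cantor \<Longrightarrow> v = 0 \<or> v = 1 \<Longrightarrow> x(n := v) \<in> cantor"
  by (simp add: mem_cantor_iff)

definition cylinder :: "nat \<Rightarrow> (nat \<Rightarrow> nat) \<Rightarrow> (nat \<Rightarrow> nat) set" where
  "cylinder n x = {y \<in> cantor. \<forall>i<n. y i = x i}"

text \<open>These are the unions of cylinders of level \<open>n\<close>: membership of a point of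
  \<open>cantor\<close> depends on its first \<open>n\<close> coordinates alone.\<close>

definition determined :: "nat \<Rightarrow> (nat \<Rightarrow> nat) set \<Rightarrow> bool" where
  "determined n A \<longleftrightarrow> A \<subseteq> cantor \<and> (\<forall>x\<in>A. cylinder n x \<subseteq> A)"

definition cylinder_sets :: "(nat \<Rightarrow> nat) set set" where
  "cylinder_sets = {A. \<exists>n. determined n A}"

lemma determined_mono: "determined m A \<Longrightarrow> m \<le> n \<Longrightarrow> determined n A"
  unfolding determined_def cylinder_def by fastforce

lemma determined_cylinder: "determined n (cylinder n x)"
  unfolding determined_def cylinder_def by auto

lemma determined_Un: "determined n A \<Longrightarrow> determined n B \<Longrightarrow> determined n (A \<union> B)"
  unfolding determined_def by blast

lemma determined_Diff: "determined n A \<Longrightarrow> determined n (cantor - A)"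
  unfolding determined_def cylinder_def by fastforce

lemma determined_cantor: "determined 0 cantor"
  unfolding determined_def cylinder_def by auto

lemma cylinder_in_cylinder_sets: "cylinder n x \<in> cylinder_sets"
  using determined_cylinder by (auto simp: cylinder_sets_def)

lemma cylinder_0: "cylinder 0 x = cantor"
  by (simp add: cylinder_def)

lemma algebra_cylinder_sets: "algebra cantor cylinder_sets"
proof (rule algebra_iff_Un[THEN iffD2], intro conjI ballI)
  show "cylinder_sets \<subseteq> Pow cantor"
    by (auto simp: cylinder_sets_def determined_def)
  show "{} \<in> cylinder_sets"
    by (auto simp: cylinder_sets_def determined_def)
  show "cantor - A \<in> cylinder_sets" if "A \<in> cylinder_sets" for A
    using that determined_Diff by (auto simp: cylinder_sets_def)
  show "A \<union> B \<in> cylinder_sets" if AB: "A \<in> cylinder_sets" "B \<in> cylinder_sets" for A B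
  proof -
    obtain m n where "determined m A" "determined n B"
      using AB by (auto simp: cylinder_sets_def)
    then have "determined (max m n) (A \<union> B)"
      by (meson determined_Un determined_mono max.cobounded1 max.cobounded2)
    then show ?thesis by (auto simp: cylinder_sets_def)
  qed
qed

lemma openin_cylinder: "openin cantor_space (cylinder n x)"
proof -
  \<comment> \<open>Intersecting with \<open>{0, 1}\<close> keeps each factor inside the discrete
    space even when \<open>x\<close> is not binary, in which case factor and cylinder may both be
    empty.\<close>
  have "cylinder n x = Pi\<^sub>E UNIV (\<lambda>i. if i < n then {x i} \<inter> {0, 1} else {0, 1})"
    unfolding cylinder_def by (auto simp: mem_cantor_iff PiE_iff split: if_splits) metis+
  moreover have "openin cantor_space (Pi\<^sub>E UNIV (\<lambda>i. if i < n then {x i} \<inter> {0, 1} else {0, 1}))"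
    unfolding cantor_space_def
    by (rule product_topology_basis) (auto intro: finite_subset[of _ "{..<n}"] split: if_splits)
  ultimately show ?thesis by simp
qed

lemma openin_determined:
  assumes "determined n A"
  shows "openin cantor_space A"
proof -
  have "A = (\<Union>x\<in>A. cylinder n x)"
    using assms unfolding determined_def cylinder_def by auto
  then show ?thesis
    by (metis (no_types, lifting) openin_cylinder imageE openin_Union)
qed

text \<open>A basic open box around \<open>x\<close> restricts finitely many coordinates; any
  \<open>n\<close> beyond all of them works.\<close>

lemma openin_cantor_cylinder:
  assumes U: "openin cantor_space U" and x: "x \<in> U"
  obtains n where "cylinder n x \<subseteq> U"
proof -
  obtain V where V: "finite {i. V i \<noteq> {0, 1}}" "x \<in> Pi\<^sub>E UNIV V" "Pi\<^sub>E UNIV V \<subseteq> U"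
    using U x unfolding cantor_space_def openin_product_topology_alt by auto
  obtain n where n: "\<And>i. V i \<noteq> {0, 1} \<Longrightarrow> i < n"
    using V(1) finite_nat_set_iff_bounded[of "{i. V i \<noteq> {0, 1}}"] by auto
  have "cylinder n x \<subseteq> Pi\<^sub>E UNIV V"
  proof
    fix y assume y: "y \<in> cylinder n x"
    have "y i \<in> V i" for i
    proof (cases "i < n")
      case True
      then have "y i = x i" using y by (simp add: cylinder_def)
      then show ?thesis using V(2) by (simp add: PiE_iff)
    next
      case False
      then have "V i = {0, 1}" using n by blast
      then show ?thesis using y by (auto simp: cylinder_def mem_cantor_iff)
    qed
    then show "y \<in> Pi\<^sub>E UNIV V" by (simp add: PiE_iff)
  qed
  with V(3) have "cylinder n x \<subseteq> U" by (rule subset_trans[rotated])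
  then show ?thesis by (rule that)
qed

text \<open>An open \<open>U\<close> must be a countable union of cylinder sets. Collecting all
  level-\<open>n\<close> cylinders inside \<open>U\<close> into one set \<open>L n\<close> replaces
  the union over points by a union over levels.\<close>

lemma sets_borel_cantor:
  "sets (borel_algebra cantor_space) = sigma_sets cantor cylinder_sets"
  unfolding sets_borel_algebra
proof (rule sigma_sets_eqI)
  fix U assume "U \<in> {U. openin cantor_space U}"
  then have U: "openin cantor_space U" by simp
  define L where "L n = {x \<in> cantor. cylinder n x \<subseteq> U}" for n
  have "determined n (L n)" for n
    unfolding L_def determined_def cylinder_def by auto
  then have "L n \<in> sigma_sets cantor cylinder_sets" for n
    by (auto simp: cylinder_sets_def intro: sigma_sets.Basic)
  moreover have "U = (\<Union>n. L n)"
  proof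
    show "U \<subseteq> (\<Union>n. L n)"
    proof
      fix x assume x: "x \<in> U"
      obtain n where "cylinder n x \<subseteq> U" by (rule openin_cantor_cylinder[OF U x])
      moreover have "x \<in> cantor" using openin_subset[OF U] x by (rule subsetD)
      ultimately show "x \<in> (\<Union>n. L n)" by (auto simp: L_def)
    qed
    show "(\<Union>n. L n) \<subseteq> U"
      by (auto simp: L_def cylinder_def)
  qed
  ultimately show "U \<in> sigma_sets cantor cylinder_sets"
    by (auto intro: sigma_sets.Union)
next
  fix A assume "A \<in> cylinder_sets"
  then show "A \<in> sigma_sets cantor {U. openin cantor_space U}"
    by (auto simp: cylinder_sets_def openin_determined)
qed

lemma cylinder_borel: "cylinder n x \<in> sets (borel_algebra cantor_space)"
  by (rule openin_in_borel_algebra[OF openin_cylinder])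

section \<open>Binary words indexing the cylinders of a level\<close>

text \<open>The points \<open>x\<close> of \<open>nodes n\<close> stand for the binary words of length \<open>n\<close>, padded by zeros.\<close>
definition nodes :: "nat \<Rightarrow> (nat \<Rightarrow> nat) set" where
  "nodes n = {x \<in> cantor. \<forall>i\<ge>n. x i = 0}"

lemma nodes_subset: "nodes n \<subseteq> cantor"
  by (auto simp: nodes_def)

lemma nodes_0: "nodes 0 = {\<lambda>_. 0}"
  by (auto simp: nodes_def mem_cantor_iff)

lemma nodes_Suc: "nodes (Suc n) = nodes n \<union> (\<lambda>x. x(n := 1)) ` nodes n"
proof
  show "nodes (Suc n) \<subseteq> nodes n \<union> (\<lambda>x. x(n := 1)) ` nodes n"
  proof
    fix x assume x: "x \<in> nodes (Suc n)"
    show "x \<in> nodes n \<union> (\<lambda>x. x(n := 1)) ` nodes n"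
    proof (cases "x n = 0")
      case True
      then have "x \<in> nodes n"
        using x by (auto simp: nodes_def) (metis le_antisym not_less_eq_eq)
      then show ?thesis by simp
    next
      case False
      have "x \<in> cantor" using x by (simp add: nodes_def)
      then have "x n = 0 \<or> x n = 1" unfolding mem_cantor_iff by (rule spec)
      then have "x n = 1" using False by simp
      then have "x = (x(n := 0))(n := 1)" "x(n := 0) \<in> nodes n"
        using x by (auto simp: nodes_def mem_cantor_iff fun_eq_iff Suc_le_eq)
      then show ?thesis by blast
    qed
  qed
qed (auto simp: nodes_def fun_upd_in_cantor)

lemma finite_nodes: "finite (nodes n)"
  by (induction n) (auto simp: nodes_0 nodes_Suc)

lemma node_nth: "x \<in> nodes n \<Longrightarrow> x n = 0"
  by (simp add: nodes_def)

text \<open>Groups the words of length \<open>n + 1\<close> by their prefix. Because of the zero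
  padding, \<open>x\<close> is its own extension by 0, and only the extension by 1 needs an
  update.\<close>

lemma sum_nodes_Suc:
  "(\<Sum>x\<in>nodes (Suc n). g x) = (\<Sum>x\<in>nodes n. g x + g (x(n := 1)))" for g :: "_ \<Rightarrow> real"
proof -
  have inj: "inj_on (\<lambda>x. x(n := 1)) (nodes n)"
    by (rule inj_onI) (metis fun_upd_triv fun_upd_upd node_nth)
  have "nodes n \<inter> (\<lambda>x. x(n := 1)) ` nodes n = {}"
    using node_nth by fastforce
  then have "(\<Sum>x\<in>nodes (Suc n). g x) = sum g (nodes n) + sum g ((\<lambda>x. x(n := 1)) ` nodes n)"
    unfolding nodes_Suc by (intro sum.union_disjoint) (auto simp: finite_nodes)
  also have "sum g ((\<lambda>x. x(n := 1)) ` nodes n) = (\<Sum>x\<in>nodes n. g (x(n := 1)))"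
    using inj by (simp add: sum.reindex)
  finally show ?thesis by (simp add: sum.distrib)
qed

lemma cylinder_disjoint:
  assumes "x \<in> nodes n" "y \<in> nodes n" "x \<noteq> y"
  shows "cylinder n x \<inter> cylinder n y = {}"
proof -
  obtain i where "x i \<noteq> y i" using assms(3) by blast
  moreover have "i < n"
    using assms \<open>x i \<noteq> y i\<close> by (metis (mono_tags, lifting) mem_Collect_eq nodes_def not_le)
  ultimately show ?thesis by (auto simp: cylinder_def)
qed

lemma mem_cylinder_self: "x \<in> cantor \<Longrightarrow> x \<in> cylinder n x"
  by (simp add: cylinder_def)

definition truncate :: "nat \<Rightarrow> (nat \<Rightarrow> nat) \<Rightarrow> nat \<Rightarrow> nat" where
  "truncate n x = (\<lambda>i. if i < n then x i else 0)"

lemma truncate_in_nodes: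
  assumes "x \<in> cantor"
  shows "truncate n x \<in> nodes n"
  using assms by (simp add: truncate_def nodes_def mem_cantor_iff)

text \<open>Lets a sum of cylinder indicators over \<open>nodes n\<close> collapse to the single
  term at \<open>truncate n y\<close>.\<close>

lemma mem_cylinder_iff_truncate:
  assumes "x \<in> nodes n" "y \<in> cantor"
  shows "y \<in> cylinder n x \<longleftrightarrow> x = truncate n y"
proof -
  have "x i = 0" if "\<not> i < n" for i
    using assms(1) that by (simp add: nodes_def not_less)
  then have "x = truncate n y \<longleftrightarrow> (\<forall>i<n. y i = x i)"
    unfolding truncate_def fun_eq_iff by auto
  then show ?thesis using assms(2) by (simp add: cylinder_def)
qed

subsection \<open>The compensation\<close>

text \<open>The word is read off the first \<open>n\<close> coordinates of a point, so the recursion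
  runs over the level alone. Coordinate \<open>n\<close> selects the half, while
  \<open>x(n := 0)\<close> names the 0-half in both branches, since the 1-half receives the
  remainder.\<close>

primrec mass :: "((nat \<Rightarrow> nat) set \<Rightarrow> real) \<Rightarrow> nat \<Rightarrow> (nat \<Rightarrow> nat) \<Rightarrow> real" where
  "mass \<mu> 0 x = max 0 (\<mu> cantor)"
| "mass \<mu> (Suc n) x =
    (let w = mass \<mu> n x; u = min w (max 0 (\<mu> (cylinder (Suc n) (x(n := 0)))))
     in if x n = 0 then u else w - u)"

lemma cylinder_cong: "(\<And>i. i < n \<Longrightarrow> x i = y i) \<Longrightarrow> cylinder n x = cylinder n y"
  by (auto simp: cylinder_def)

lemma mass_cong: "(\<And>i. i < n \<Longrightarrow> x i = y i) \<Longrightarrow> mass \<mu> n x = mass \<mu> n y"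
proof (induction n)
  case (Suc n)
  have "cylinder (Suc n) (x(n := 0)) = cylinder (Suc n) (y(n := 0))"
    using Suc.prems by (intro cylinder_cong) auto
  moreover have "mass \<mu> n x = mass \<mu> n y" "x n = y n"
    using Suc by auto
  ultimately show ?case by (simp add: Let_def)
qed simp

lemma mass_children:
  assumes "x \<in> nodes n"
  shows "mass \<mu> (Suc n) x + mass \<mu> (Suc n) (x(n := 1)) = mass \<mu> n x"
proof -
  have "x(n := 0) = x" using node_nth[OF assms] by (rule fun_upd_idem)
  moreover have "mass \<mu> n (x(n := 1)) = mass \<mu> n x" by (rule mass_cong) auto
  ultimately show ?thesis using node_nth[OF assms] by (simp add: Let_def)
qed

text \<open>Induction on the level. Let \<open>w\<close> be the mass of a cylinder whose halves have
  measures \<open>l\<close> and \<open>r\<close>. The remainder \<open>w - min w (max 0 l)\<close>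
  is 0, or else it is \<open>w - max 0 l\<close>, which is at most \<open>max 0 r\<close> because
  \<open>w \<le> max 0 (l + r) \<le> max 0 l + max 0 r\<close>.\<close>

lemma mass_bounds:
  assumes \<mu>: "signed_borel_measure cantor_space \<mu>" and x: "x \<in> cantor"
  shows "0 \<le> mass \<mu> n x \<and> mass \<mu> n x \<le> max 0 (\<mu> (cylinder n x))"
  using x
proof (induction n)
  case (Suc n)
  let ?L = "cylinder (Suc n) (x(n := 0))" and ?R = "cylinder (Suc n) (x(n := 1))"
  have "\<mu> (?L \<union> ?R) = \<mu> ?L + \<mu> ?R"
    by (intro signed_borel_measure_Un[OF \<mu>] cylinder_borel) (auto simp: cylinder_def)
  moreover have "?L \<union> ?R = cylinder n x"
    by (auto simp: cylinder_def mem_cantor_iff less_Suc_eq)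
  ultimately have eq: "\<mu> (cylinder n x) = \<mu> ?L + \<mu> ?R" by simp
  consider "x n = 0" "x(n := 0) = x" | "x n \<noteq> 0" "x(n := 1) = x"
    using Suc.prems by (metis fun_upd_triv mem_cantor_iff)
  then have "mass \<mu> (Suc n) x = min (mass \<mu> n x) (max 0 (\<mu> ?L)) \<and> cylinder (Suc n) x = ?L \<or>
      mass \<mu> (Suc n) x = mass \<mu> n x - min (mass \<mu> n x) (max 0 (\<mu> ?L)) \<and> cylinder (Suc n) x = ?R"
    by cases (simp_all add: Let_def)
  moreover have "0 \<le> min w (max 0 l) \<and> min w (max 0 l) \<le> max 0 l \<and>
      0 \<le> w - min w (max 0 l) \<and> w - min w (max 0 l) \<le> max 0 r"
    if "0 \<le> w" "w \<le> max 0 (l + r)" for w l r :: real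
    using that by linarith
  moreover have "0 \<le> mass \<mu> n x" "mass \<mu> n x \<le> max 0 (\<mu> ?L + \<mu> ?R)"
    using Suc eq by simp_all
  ultimately show ?case by metis
qed (simp add: cylinder_0)

section \<open>The premeasure on cylinder sets\<close>

text \<open>The discrete measure that concentrates the mass of each level-\<open>n\<close> cylinder
  at its zero-padded point.\<close>

definition stage :: "((nat \<Rightarrow> nat) set \<Rightarrow> real) \<Rightarrow> nat \<Rightarrow> (nat \<Rightarrow> nat) set \<Rightarrow> real" where
  "stage \<mu> n A = (\<Sum>x\<in>nodes n. mass \<mu> n x * indicator A x)"

text \<open>The limit spares the choice of a level: on a cylinder set the stages are eventually
  constant.\<close>

definition premeasure :: "((nat \<Rightarrow> nat) set \<Rightarrow> real) \<Rightarrow> (nat \<Rightarrow> nat) set \<Rightarrow> real" where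
  "premeasure \<mu> A = lim (\<lambda>n. stage \<mu> n A)"

text \<open>The two extensions of a node lie in the same level-\<open>n\<close> cylinder, so
  \<open>A\<close> contains both or neither, and their masses add up to the mass of the
  node.\<close>

lemma stage_Suc:
  assumes "determined n A"
  shows "stage \<mu> (Suc n) A = stage \<mu> n A"
proof -
  have "indicator A (x(n := 1)) = (indicator A x :: real)" if x: "x \<in> nodes n" for x
  proof -
    have "x \<in> cantor" "x(n := 1) \<in> cantor" using x by (auto simp: nodes_def fun_upd_in_cantor)
    then have "x(n := 1) \<in> cylinder n x" "x \<in> cylinder n (x(n := 1))"
      by (auto simp: cylinder_def)
    then have "x(n := 1) \<in> A \<longleftrightarrow> x \<in> A" using assms unfolding determined_def by blast
    then show ?thesis by (simp add: indicator_def)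
  qed
  then have "mass \<mu> (Suc n) x * indicator A x + mass \<mu> (Suc n) (x(n := 1)) * indicator A (x(n := 1))
      = mass \<mu> n x * indicator A x" if "x \<in> nodes n" for x
    using that by (simp add: mass_children flip: distrib_right del: mass.simps One_nat_def)
  then show ?thesis
    unfolding stage_def sum_nodes_Suc by (rule sum.cong[OF refl])
qed

lemma premeasure_eq_stage:
  assumes "determined n A"
  shows "premeasure \<mu> A = stage \<mu> n A"
proof -
  have "stage \<mu> m A = stage \<mu> n A" if "n \<le> m" for m
    using that
  proof (induction m rule: dec_induct)
    case (step m)
    then show ?case using stage_Suc[OF determined_mono[OF assms]] by simp
  qed simp
  then have "(\<lambda>n. stage \<mu> n A) \<longlonglongrightarrow> stage \<mu> n A"
    by (intro tendsto_eventually eventually_sequentiallyI)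
  then show ?thesis unfolding premeasure_def by (rule limI)
qed

lemma premeasure_Un:
  assumes "A \<in> cylinder_sets" "B \<in> cylinder_sets" "A \<inter> B = {}"
  shows "premeasure \<mu> (A \<union> B) = premeasure \<mu> A + premeasure \<mu> B"
proof -
  obtain m m' where "determined m A" "determined m' B"
    using assms by (auto simp: cylinder_sets_def)
  then obtain n where n: "determined n A" "determined n B"
    by (meson determined_mono max.cobounded1 max.cobounded2)
  have "indicator (A \<union> B) x = (indicator A x + indicator B x :: real)" for x
    using assms(3) by (auto simp: indicator_def)
  then show ?thesis
    using n determined_Un[OF n]
    by (simp add: premeasure_eq_stage stage_def distrib_left sum.distrib)
qed

lemma premeasure_cantor: "premeasure \<mu> cantor = max 0 (\<mu> cantor)"
  using premeasure_eq_stage[OF determined_cantor]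
  by (simp add: stage_def nodes_0 mem_cantor_iff indicator_def)

lemma premeasure_cylinder:
  assumes "x \<in> nodes n"
  shows "premeasure \<mu> (cylinder n x) = mass \<mu> n x"
proof -
  have "mass \<mu> n y * indicator (cylinder n x) y = (if y = x then mass \<mu> n x else 0)"
    if "y \<in> nodes n" for y
  proof (cases "y = x")
    case True
    moreover have "x \<in> cylinder n x"
      using assms nodes_subset by (intro mem_cylinder_self) blast
    ultimately show ?thesis by simp
  next
    case False
    then have "y \<notin> cylinder n x"
      using cylinder_disjoint[OF assms that] that nodes_subset mem_cylinder_self by blast
    then show ?thesis using False by simp
  qed
  then have "stage \<mu> n (cylinder n x) = (\<Sum>y\<in>nodes n. if y = x then mass \<mu> n x else 0)"
    unfolding stage_def by (rule sum.cong[OF refl])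
  then show ?thesis
    using assms finite_nodes premeasure_eq_stage[OF determined_cylinder] by simp
qed

lemma premeasure_nonneg:
  assumes \<mu>: "signed_borel_measure cantor_space \<mu>" and "A \<in> cylinder_sets"
  shows "0 \<le> premeasure \<mu> A"
proof -
  obtain n where "determined n A" using assms by (auto simp: cylinder_sets_def)
  moreover have "0 \<le> mass \<mu> n x" if "x \<in> nodes n" for x
    using mass_bounds[OF \<mu>, of x n] that nodes_subset by blast
  ultimately show ?thesis
    by (auto simp: premeasure_eq_stage stage_def intro!: sum_nonneg mult_nonneg_nonneg)
qed

text \<open>Here \<open>M\<close> is \<open>\<mu>\<^sup>+\<close> packaged as a measure. It
  dominates the mass of each cylinder, and the disjoint cylinders of the nodes in \<open>A\<close>
  all lie inside \<open>A\<close>.\<close>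

lemma premeasure_le:
  assumes \<mu>: "signed_borel_measure cantor_space \<mu>" and "A \<in> cylinder_sets"
    and M: "finite_measure M" "sets M = sets (borel_algebra cantor_space)"
      "\<And>A. A \<in> sets M \<Longrightarrow> measure M A = pos_part cantor_space \<mu> A"
  shows "premeasure \<mu> A \<le> measure M A"
proof -
  interpret finite_measure M by (rule M)
  obtain n where n: "determined n A" using assms by (auto simp: cylinder_sets_def)
  have cyl: "cylinder n x \<in> sets M" for x using cylinder_borel M by simp
  have "mass \<mu> n x \<le> measure M (cylinder n x)" if "x \<in> nodes n" for x
  proof -
    have "x \<in> cantor" using that nodes_subset by blast
    then have "mass \<mu> n x \<le> max 0 (\<mu> (cylinder n x))" using mass_bounds[OF \<mu>] by blast
    also have "\<dots> \<le> measure M (cylinder n x)"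
      using M(3)[OF cyl] pos_part_nonneg[OF \<mu>] pos_part_ge[OF \<mu>] cylinder_borel by auto
    finally show ?thesis .
  qed
  then have "premeasure \<mu> A \<le> (\<Sum>x\<in>nodes n \<inter> A. measure M (cylinder n x))"
    unfolding premeasure_eq_stage[OF n] stage_def
    by (auto simp: finite_nodes sum.inter_restrict indicator_def intro!: sum_mono)
  also have "\<dots> = measure M (\<Union>x\<in>nodes n \<inter> A. cylinder n x)"
    using finite_nodes cyl cylinder_disjoint
    by (intro finite_measure_finite_Union[symmetric]) (auto simp: disjoint_family_on_def)
  also have "\<dots> \<le> measure M A"
    using n openin_determined[OF n] M(2) openin_in_borel_algebra
    by (intro finite_measure_mono) (auto simp: determined_def)
  finally show ?thesis .
qed

section \<open>The compensating measure\<close>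

lemma compensation_measure_exists:
  assumes "\<mu> \<in> signed_measures cantor_space"
  shows "\<exists>N. finite_measure N \<and> sets N = sets (borel_algebra cantor_space) \<and>
    (\<forall>n. \<forall>x\<in>nodes n. measure N (cylinder n x) = mass \<mu> n x) \<and>
    measure N cantor = max 0 (\<mu> cantor) \<and>
    (\<forall>A\<in>sets (borel_algebra cantor_space). measure N A \<le> pos_part cantor_space \<mu> A)"
proof -
  have \<mu>: "signed_borel_measure cantor_space \<mu>" using assms by (simp add: signed_measures_def)
  note * = pos_part_sums[OF \<mu>] pos_part_nonneg[OF \<mu>] pos_part_empty[OF \<mu>]
  define M where "M = to_measure cantor_space (pos_part cantor_space \<mu>)"
  have sets_M: "sets M = sets (borel_algebra cantor_space)"
    unfolding M_def by (rule sets_to_measure[of cantor_space "pos_part cantor_space \<mu>", OF *])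
  have fin_M: "finite_measure M"
    unfolding M_def
    by (rule finite_measure_to_measure[of cantor_space "pos_part cantor_space \<mu>", OF *])
  have M: "measure M A = pos_part cantor_space \<mu> A" if "A \<in> sets M" for A
    using emeasure_to_measure[of cantor_space "pos_part cantor_space \<mu>", OF * that[unfolded sets_M]] *(2)
    by (simp add: measure_def M_def)
  have space_M: "space M = cantor"
    using sets_eq_imp_space_eq[OF sets_M] by simp
  interpret M: finite_measure M by (rule fin_M)
  obtain N where N: "finite_measure N" "sets N = sets M"
    "\<And>A. A \<in> cylinder_sets \<Longrightarrow> measure N A = premeasure \<mu> A"
    "\<And>A. A \<in> sets M \<Longrightarrow> measure N A \<le> measure M A"
  proof (rule M.dominated_premeasure_extension_le[of cylinder_sets "premeasure \<mu>"])
    show "algebra (space M) cylinder_sets"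
      by (simp add: space_M algebra_cylinder_sets)
    show "sets M = sigma_sets (space M) cylinder_sets"
      by (simp add: space_M sets_M sets_borel_cantor)
  qed (use premeasure_nonneg[OF \<mu>] premeasure_Un premeasure_le[OF \<mu> _ fin_M sets_M M] in auto)
  have "cantor \<in> cylinder_sets" using determined_cantor by (auto simp: cylinder_sets_def)
  then show ?thesis
    using N sets_M M premeasure_cylinder cylinder_in_cylinder_sets premeasure_cantor
    by (intro exI[of _ N]) simp
qed

definition compensation_measure :: "((nat \<Rightarrow> nat) set \<Rightarrow> real) \<Rightarrow> (nat \<Rightarrow> nat) measure" where
  "compensation_measure \<mu> = (SOME N. finite_measure N \<and>
    sets N = sets (borel_algebra cantor_space) \<and>
    (\<forall>n. \<forall>x\<in>nodes n. measure N (cylinder n x) = mass \<mu> n x) \<and>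
    measure N cantor = max 0 (\<mu> cantor) \<and>
    (\<forall>A\<in>sets (borel_algebra cantor_space). measure N A \<le> pos_part cantor_space \<mu> A))"

lemma
  assumes "\<mu> \<in> signed_measures cantor_space"
  shows finite_compensation_measure: "finite_measure (compensation_measure \<mu>)"
    and sets_compensation_measure:
      "sets (compensation_measure \<mu>) = sets (borel_algebra cantor_space)"
    and compensation_measure_cylinder:
      "x \<in> nodes n \<Longrightarrow> measure (compensation_measure \<mu>) (cylinder n x) = mass \<mu> n x"
    and compensation_measure_cantor:
      "measure (compensation_measure \<mu>) cantor = max 0 (\<mu> cantor)"
    and compensation_measure_le:
      "A \<in> sets (borel_algebra cantor_space) \<Longrightarrow>
        measure (compensation_measure \<mu>) A \<le> pos_part cantor_space \<mu> A"
proof -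
  note * = someI_ex[OF compensation_measure_exists[OF assms], folded compensation_measure_def]
  show "finite_measure (compensation_measure \<mu>)"
    and "sets (compensation_measure \<mu>) = sets (borel_algebra cantor_space)"
    and "measure (compensation_measure \<mu>) cantor = max 0 (\<mu> cantor)"
    using * by blast+
  show "measure (compensation_measure \<mu>) (cylinder n x) = mass \<mu> n x" if "x \<in> nodes n"
    using * that by blast
  show "measure (compensation_measure \<mu>) A \<le> pos_part cantor_space \<mu> A"
    if "A \<in> sets (borel_algebra cantor_space)"
    using * that by blast
qed

lemma is_compensation_compensation_measure:
  assumes \<mu>: "\<mu> \<in> signed_measures cantor_space"
  shows "is_compensation cantor_space \<mu> (measure (compensation_measure \<mu>))"
proof -
  interpret finite_measure "compensation_measure \<mu>" by (rule finite_compensation_measure[OF \<mu>])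
  have "measure (compensation_measure \<mu>) \<in> signed_measures cantor_space"
    by (rule signed_measures_dominated[OF sets_compensation_measure[OF \<mu>]
          finite_compensation_measure[OF \<mu>] Hausdorff_space_cantor_space \<mu>
          compensation_measure_le[OF \<mu>]])
  \<comment> \<open>The compensation must be the zero function, on non-Borel sets too. The total
    mass is \<open>max 0 (\<mu> cantor) = 0\<close>, and it bounds \<open>measure\<close> on every
    set.\<close>
  moreover have "measure (compensation_measure \<mu>) A = 0" if "\<mu> cantor \<le> 0" for A
  proof -
    have "measure (compensation_measure \<mu>) A \<le> measure (compensation_measure \<mu>) cantor"
      using bounded_measure[of A] sets_eq_imp_space_eq[OF sets_compensation_measure[OF \<mu>]] by simp
    then show ?thesis
      using that compensation_measure_cantor[OF \<mu>] measure_nonneg[of "compensation_measure \<mu>" A]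
      by simp
  qed
  ultimately show ?thesis
    using compensation_measure_cantor[OF \<mu>] compensation_measure_le[OF \<mu>]
    by (auto simp: is_compensation_def)
qed

subsection \<open>Weak-star continuity\<close>

text \<open>Uniform continuity by compactness: the sets \<open>U n\<close> of points around which
  \<open>f\<close> oscillates by less than \<open>e\<close> on the level-\<open>n\<close> cylinder
  are open, increase with \<open>n\<close> and cover the space.\<close>

lemma continuous_cantor_uniform:
  assumes f: "continuous_map cantor_space euclideanreal f" and e: "e > 0"
  obtains n where "\<And>x y. x \<in> cantor \<Longrightarrow> y \<in> cylinder n x \<Longrightarrow> \<bar>f y - f x\<bar> < e"
proof -
  define U where "U n = {x \<in> cantor. \<forall>y\<in>cylinder n x. \<forall>z\<in>cylinder n x. \<bar>f y - f z\<bar> < e}" for n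
  have det: "determined n (U n)" for n
  proof -
    have "cylinder n y = cylinder n x" if "y \<in> cylinder n x" for x y
      using that by (intro cylinder_cong) (simp add: cylinder_def)
    then show ?thesis
      unfolding determined_def U_def by (auto simp: cylinder_def)
  qed
  have mono: "U m \<subseteq> U n" if "m \<le> n" for m n
  proof -
    have "cylinder n x \<subseteq> cylinder m x" for x using that by (auto simp: cylinder_def)
    then show ?thesis unfolding U_def by blast
  qed
  have "cantor \<subseteq> (\<Union>n. U n)"
  proof
    fix x assume x: "x \<in> cantor"
    have "openin cantor_space {y \<in> cantor. f y \<in> ball (f x) (e/2)}"
      using f by (rule openin_continuous_map_preimage) simp
    then obtain n where n: "cylinder n x \<subseteq> {y \<in> cantor. f y \<in> ball (f x) (e/2)}"
    proof (rule openin_cantor_cylinder)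
      show "x \<in> {y \<in> cantor. f y \<in> ball (f x) (e/2)}" using x e by simp
    qed
    have "\<bar>f y - f z\<bar> < e" if "y \<in> cylinder n x" "z \<in> cylinder n x" for y z
    proof -
      have "dist (f x) (f y) < e/2" "dist (f x) (f z) < e/2" using n that by auto
      then show ?thesis unfolding dist_real_def by linarith
    qed
    then show "x \<in> (\<Union>n. U n)" using x by (auto simp: U_def)
  qed
  moreover have "compactin cantor_space cantor"
    using compact_space_cantor_space by (simp add: compact_space_def)
  ultimately obtain F where F: "finite F" "F \<subseteq> range U" "cantor \<subseteq> \<Union>F"
    unfolding compactin_def using openin_determined[OF det] by (metis (no_types, lifting) imageE)
  then obtain I where I: "finite I" "F = U ` I"
    by (metis finite_subset_image)
  \<comment> \<open>By monotonicity the finite subcover collapses to one level;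
    \<open>insert 0\<close> keeps the argument of \<open>Max\<close> nonempty.\<close>
  have "U i \<subseteq> U (Max (insert 0 I))" if "i \<in> I" for i
    using I(1) that by (intro mono Max_ge) auto
  then have U_max: "cantor \<subseteq> U (Max (insert 0 I))" using F(3) I(2) by blast
  show ?thesis
  proof (rule that)
    fix x y assume "x \<in> cantor" "y \<in> cylinder (Max (insert 0 I)) x"
    then show "\<bar>f y - f x\<bar> < e"
      using U_max mem_cylinder_self[of x] unfolding U_def by blast
  qed
qed

lemma continuous_map_weak_star_integral:
  assumes "continuous_map K euclideanreal f"
  shows "continuous_map (weak_star K) euclideanreal (\<lambda>\<mu>. signed_integral K \<mu> f)"
  unfolding continuous_map_def
proof (intro conjI allI impI)
  fix V assume "openin euclideanreal V"
  then show "openin (weak_star K) {\<mu> \<in> topspace (weak_star K). signed_integral K \<mu> f \<in> V}"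
    unfolding topspace_weak_star unfolding weak_star_def
    using assms by (intro topology_generated_by_Basis) auto
qed simp

text \<open>The indicator of a cylinder is continuous because its preimages are determined by
  \<open>n\<close> coordinates; integrating it evaluates \<open>\<mu>\<close> at the
  cylinder.\<close>

lemma continuous_map_weak_star_cylinder:
  "continuous_map (weak_star cantor_space) euclideanreal (\<lambda>\<mu>. \<mu> (cylinder n x))"
proof (rule continuous_map_eq)
  have "continuous_map cantor_space euclideanreal (indicator (cylinder n x))"
    unfolding continuous_map_def
  proof (intro conjI allI impI)
    fix V :: "real set"
    have "determined n {y \<in> cantor. indicator (cylinder n x) y \<in> V}"
      unfolding determined_def cylinder_def by (auto simp: indicator_def)
    then show "openin cantor_space {y \<in> cantor. indicator (cylinder n x) y \<in> V}"
      by (rule openin_determined)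
  qed simp
  then show "continuous_map (weak_star cantor_space) euclideanreal
      (\<lambda>\<mu>. signed_integral cantor_space \<mu> (indicator (cylinder n x)))"
    by (rule continuous_map_weak_star_integral)
qed (simp add: topspace_weak_star signed_measures_def signed_integral_indicator cylinder_borel)

lemma continuous_map_weak_star_mass:
  "continuous_map (weak_star cantor_space) euclideanreal (\<lambda>\<mu>. mass \<mu> n x)"
proof (induction n arbitrary: x)
  case 0
  then show ?case
    using continuous_map_weak_star_cylinder[of 0 x]
    by (simp add: cylinder_0 continuous_map_real_max)
next
  case (Suc n)
  then show ?case
    by (cases "x n = 0")
      (auto simp: Let_def intro!: continuous_intros continuous_map_weak_star_cylinder)
qed

text \<open>Replacing \<open>f\<close> by the step function \<open>g\<close>, constant on
  level-\<open>n\<close> cylinders, costs at most \<open>e\<close> at each point, hence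
  \<open>e\<close> times the total mass. That mass is \<open>mass \<mu> 0 z\<close> for any
  \<open>z\<close>, as level 0 ignores the point.\<close>

lemma integral_compensation_approx:
  assumes \<mu>: "\<mu> \<in> signed_measures cantor_space"
    and f: "continuous_map cantor_space euclideanreal f"
    and n: "\<And>x y. x \<in> cantor \<Longrightarrow> y \<in> cylinder n x \<Longrightarrow> \<bar>f y - f x\<bar> < e"
  shows "\<bar>(\<integral>x. f x \<partial>compensation_measure \<mu>) - (\<Sum>x\<in>nodes n. f x * mass \<mu> n x)\<bar>
    \<le> e * mass \<mu> 0 z"
proof -
  let ?N = "compensation_measure \<mu>"
  define g where "g y = (\<Sum>x\<in>nodes n. f x * indicator (cylinder n x) y)" for y
  note sets = sets_compensation_measure[OF \<mu>]
  interpret finite_measure ?N by (rule finite_compensation_measure[OF \<mu>])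
  have space: "space ?N = cantor"
    using sets_eq_imp_space_eq[OF sets] by simp
  have cyl: "cylinder n x \<in> sets ?N" for x
    using sets cylinder_borel by simp
  have g: "g y = f (truncate n y)" if "y \<in> cantor" for y
  proof -
    have "g y = (\<Sum>x\<in>nodes n. if x = truncate n y then f x else 0)"
      unfolding g_def
      by (intro sum.cong) (auto simp: mem_cylinder_iff_truncate that indicator_def)
    then show ?thesis using truncate_in_nodes[OF that] by (simp add: finite_nodes)
  qed
  have close: "\<bar>f y - g y\<bar> \<le> e" if "y \<in> cantor" for y
  proof -
    have "truncate n y \<in> cantor" "y \<in> cylinder n (truncate n y)"
      using truncate_in_nodes[OF that, of n] nodes_subset that mem_cylinder_iff_truncate by blast+
    then show ?thesis using n[of "truncate n y" y] g[OF that] by simp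
  qed
  have int_g: "integrable ?N g"
    unfolding g_def using cyl by (auto intro!: integrable_real_indicator emeasure_finite
      simp: less_top[symmetric])
  have meas: "(\<lambda>y. f y - g y) \<in> borel_measurable ?N"
    using int_g borel_measurable_continuous_map[OF f sets] by measurable
  \<comment> \<open>Integrability of \<open>f\<close> comes from that of \<open>g\<close> and of the
    bounded difference \<open>f - g\<close> on a finite measure space.\<close>
  have int_fg: "integrable ?N (\<lambda>y. f y - g y)"
    using close space by (intro integrable_const_bound[OF _ meas, of e] AE_I2) simp
  have "integrable ?N (\<lambda>y. (f y - g y) + g y)"
    by (rule Bochner_Integration.integrable_add[OF int_fg int_g])
  then have int_f: "integrable ?N f" by simp
  have "(\<integral>y. g y \<partial>?N) = (\<Sum>x\<in>nodes n. f x * mass \<mu> n x)"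
  proof -
    have "(\<integral>y. g y \<partial>?N) = (\<Sum>x\<in>nodes n. \<integral>y. f x * indicator (cylinder n x) y \<partial>?N)"
      unfolding g_def using cyl
      by (intro Bochner_Integration.integral_sum)
        (auto intro!: integrable_real_indicator emeasure_finite simp: less_top[symmetric])
    also have "\<dots> = (\<Sum>x\<in>nodes n. f x * mass \<mu> n x)"
    proof (rule sum.cong)
      fix x assume "x \<in> nodes n"
      moreover have "cylinder n x \<inter> space ?N = cylinder n x"
        using space by (auto simp: cylinder_def)
      ultimately show "(\<integral>y. f x * indicator (cylinder n x) y \<partial>?N) = f x * mass \<mu> n x"
        using compensation_measure_cylinder[OF \<mu>] by simp
    qed simp
    finally show ?thesis .
  qed
  then have "\<bar>(\<integral>x. f x \<partial>?N) - (\<Sum>x\<in>nodes n. f x * mass \<mu> n x)\<bar> = \<bar>\<integral>y. f y - g y \<partial>?N\<bar>"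
    using int_f int_g by simp
  also have "\<dots> \<le> (\<integral>y. \<bar>f y - g y\<bar> \<partial>?N)" by (rule integral_abs_bound)
  also have "\<dots> \<le> (\<integral>y. e \<partial>?N)"
    using int_fg close space by (intro integral_mono) auto
  also have "\<dots> = e * mass \<mu> 0 z"
    using compensation_measure_cantor[OF \<mu>] space by simp
  finally show ?thesis .
qed

text \<open>A local form of the uniform limit theorem. The tolerance \<open>r\<close> is split in
  three: the approximation errors at \<open>x\<close> and at \<open>y\<close>, and the variation of
  \<open>g\<close> between them.\<close>

lemma continuous_map_real_locally_approx:
  fixes h :: "'a \<Rightarrow> real"
  assumes "\<And>x e. x \<in> topspace X \<Longrightarrow> e > 0 \<Longrightarrow>
    \<exists>g U. continuous_map X euclideanreal g \<and> openin X U \<and> x \<in> U \<and> (\<forall>y\<in>U. \<bar>h y - g y\<bar> \<le> e)"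
  shows "continuous_map X euclideanreal h"
  unfolding continuous_map_def
proof (intro conjI allI impI)
  fix V :: "real set" assume "openin euclideanreal V"
  then have V: "open V" by simp
  show "openin X {x \<in> topspace X. h x \<in> V}"
  proof (subst openin_subopen, intro ballI)
    fix x assume "x \<in> {x \<in> topspace X. h x \<in> V}"
    then have x: "x \<in> topspace X" "h x \<in> V" by auto
    obtain r where r: "r > 0" "ball (h x) r \<subseteq> V" using V x by (meson open_contains_ball)
    obtain g U where g: "continuous_map X euclideanreal g" and U: "openin X U" "x \<in> U"
      and gU: "\<And>y. y \<in> U \<Longrightarrow> \<bar>h y - g y\<bar> \<le> r/3"
      using assms[OF x(1), of "r/3"] r by auto
    define W where "W = U \<inter> {y \<in> topspace X. g y \<in> ball (g x) (r/3)}"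
    have "openin X W"
      unfolding W_def using U(1) openin_continuous_map_preimage[OF g, of "ball (g x) (r/3)"]
      by (intro openin_Int) simp_all
    moreover have "x \<in> W" using x U r by (simp add: W_def)
    moreover have "W \<subseteq> {x \<in> topspace X. h x \<in> V}"
    proof
      fix y assume y: "y \<in> W"
      then have "\<bar>g x - g y\<bar> < r/3" "\<bar>h y - g y\<bar> \<le> r/3" "\<bar>h x - g x\<bar> \<le> r/3"
        using gU U by (auto simp: W_def dist_real_def)
      then have "\<bar>h x - h y\<bar> < r" by linarith
      then have "h y \<in> V" using r(2) by (auto simp: dist_real_def subset_iff)
      then show "y \<in> {x \<in> topspace X. h x \<in> V}" using y by (simp add: W_def)
    qed
    ultimately show "\<exists>T. openin X T \<and> x \<in> T \<and> T \<subseteq> {x \<in> topspace X. h x \<in> V}" by blast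
  qed
qed simp

lemma continuous_map_integral_compensation:
  assumes f: "continuous_map cantor_space euclideanreal f"
  shows "continuous_map (weak_star cantor_space) euclideanreal
    (\<lambda>\<mu>. \<integral>x. f x \<partial>compensation_measure \<mu>)"
proof (rule continuous_map_real_locally_approx)
  fix \<mu> and e :: real assume \<mu>: "\<mu> \<in> topspace (weak_star cantor_space)" and e: "e > 0"
  let ?W = "weak_star cantor_space" and ?m = "\<lambda>\<mu>. mass \<mu> 0 (\<lambda>_. 0)"
  \<comment> \<open>The approximation error is \<open>d\<close> times the total mass, which has no
    bound over all signed measures. On the neighbourhood \<open>?U\<close> of \<open>\<mu>\<close>
    it stays below \<open>?m \<mu> + 1\<close>, and \<open>d\<close> is scaled to make the error at
    most \<open>e\<close> there.\<close>
  define d where "d = e / (?m \<mu> + 1)"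
  have d: "d > 0" using e by (simp add: d_def add_nonneg_pos)
  obtain n where n: "\<And>x y. x \<in> cantor \<Longrightarrow> y \<in> cylinder n x \<Longrightarrow> \<bar>f y - f x\<bar> < d"
    using continuous_cantor_uniform[OF f d] by blast
  let ?g = "\<lambda>\<mu>. \<Sum>x\<in>nodes n. f x * mass \<mu> n x"
  let ?U = "{\<rho> \<in> topspace ?W. ?m \<rho> \<in> {..<?m \<mu> + 1}}"
  have "continuous_map ?W euclideanreal ?g"
    by (intro continuous_map_sum continuous_map_real_mult_left continuous_map_weak_star_mass)
      (rule finite_nodes)
  moreover have "openin ?W ?U"
    using continuous_map_weak_star_mass by (rule openin_continuous_map_preimage) simp
  moreover have "\<bar>(\<integral>x. f x \<partial>compensation_measure \<rho>) - ?g \<rho>\<bar> \<le> e" if \<rho>: "\<rho> \<in> ?U" for \<rho>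
  proof -
    have "\<bar>(\<integral>x. f x \<partial>compensation_measure \<rho>) - ?g \<rho>\<bar> \<le> d * ?m \<rho>"
      using \<rho> by (intro integral_compensation_approx f n) (auto simp: topspace_weak_star)
    also have "\<dots> \<le> d * (?m \<mu> + 1)"
      using \<rho> d by (intro mult_left_mono) auto
    also have "\<dots> = e" using e by (simp add: d_def max_def)
    finally show ?thesis .
  qed
  ultimately show "\<exists>g U. continuous_map ?W euclideanreal g \<and> openin ?W U \<and> \<mu> \<in> U \<and>
      (\<forall>\<rho>\<in>U. \<bar>(\<integral>x. f x \<partial>compensation_measure \<rho>) - g \<rho>\<bar> \<le> e)"
    using \<mu> by (intro exI[of _ ?g] exI[of _ ?U]) auto
qed

theorem theorem3p6:
  shows "admits_compensation_function cantor_space"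
proof -
  let ?\<xi> = "\<lambda>\<mu>. measure (compensation_measure \<mu>)" and ?W = "weak_star cantor_space"
  have comp: "is_compensation cantor_space \<mu> (?\<xi> \<mu>)" if "\<mu> \<in> signed_measures cantor_space" for \<mu>
    using that by (rule is_compensation_compensation_measure)
  then have meas: "?\<xi> \<mu> \<in> signed_measures cantor_space" if "\<mu> \<in> signed_measures cantor_space" for \<mu>
    using that by (simp add: is_compensation_def)
  \<comment> \<open>Continuity into a generated topology is tested on the generating sets; folding
    \<open>weak_star_def\<close> back restores the topology of the domain.\<close>
  have "continuous_map ?W ?W ?\<xi>"
    unfolding weak_star_def[of cantor_space] continuous_on_generated_topo_iff
    unfolding weak_star_def[symmetric] topspace_weak_star
  proof (intro conjI allI impI)
    fix S assume "S \<in> {{\<mu> \<in> signed_measures cantor_space. signed_integral cantor_space \<mu> f \<in> V} |f V.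
        continuous_map cantor_space euclideanreal f \<and> open V}"
    then obtain f V where f: "continuous_map cantor_space euclideanreal f" and V: "open V"
      and S: "S = {\<mu> \<in> signed_measures cantor_space. signed_integral cantor_space \<mu> f \<in> V}"
      by blast
    \<comment> \<open>For the nonnegative \<open>?\<xi> \<mu>\<close> the signed integral is the
      ordinary one, so this preimage is that of \<open>V\<close> under a map already known to be
      continuous.\<close>
    have "?\<xi> -` S \<inter> signed_measures cantor_space =
        {\<mu> \<in> topspace ?W. (\<integral>x. f x \<partial>compensation_measure \<mu>) \<in> V}"
      using meas
      by (auto simp: S topspace_weak_star finite_compensation_measure sets_compensation_measure
          signed_integral_measure)
    then show "openin ?W (?\<xi> -` S \<inter> signed_measures cantor_space)"
      using continuous_map_integral_compensation[OF f] V by (simp add: continuous_map_def)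
  next
    have "signed_measures cantor_space \<subseteq> \<Union> {{\<mu> \<in> signed_measures cantor_space.
        signed_integral cantor_space \<mu> f \<in> V} |f V.
        continuous_map cantor_space euclideanreal f \<and> open V}"
      using topspace_weak_star[of cantor_space]
      unfolding weak_star_def topology_generated_by_topspace by simp
    then show "?\<xi> ` signed_measures cantor_space \<subseteq> \<Union> {{\<mu> \<in> signed_measures cantor_space.
        signed_integral cantor_space \<mu> f \<in> V} |f V.
        continuous_map cantor_space euclideanreal f \<and> open V}"
      using meas by blast
  qed
  then show ?thesis
    using comp unfolding admits_compensation_function_def compensation_function_def by blast
qed

end
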